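(* Let $H_1,H_2$ be real Hilbert spaces, $C:H_1\to H_2$ a bounded linear mapping with adjoint $C^T:H_2\to H_1$, and $\mathcal{M}:H_2\rightrightarrows H_2$ a maximal monotone operator. Let $\lambda>0$ and $y\in H_1$ be given. Then $J_{\lambda C^T\mathcal{M}C}\,y=y-\lambda\mu C^Tu$, where $u$ is the fixed point of the operator $\mathcal{Q}:H_2\to H_2$ defined by $$u\mapsto\mathcal{Q}(u):=\big(I-J_{\frac1\mu\mathcal{M}}\big)\Big(Cy+\big(I-\lambda\mu CC^T\big)u\Big),\qquad \mu>0.$$ Furthermore, if $\lambda\mu\le\frac{2}{\|C\|^2}$, then $\|I-\lambda\mu CC^T\|\le1$, thereby ensuring that $\mathcal{Q}$ is nonexpansive.
   Context: The composite $C^T\mathcal{M}C:H_1\rightrightarrows H_1$ is $C^T\mathcal{M}C(x)=\{C^Tu^*: u^*\in\mathcal{M}(Cx)\}$. The resolvent of an operator $\mathcal{A}$ is $J_{\mathcal{A}}=(I+\mathcal{A})^{-1}$, so $x=J_{\lambda C^T\mathcal{M}C}\,y$ means that $x\in H_1$ satisfies $y\in x+\lambda C^T\mathcal{M}Cx$. Nonexpansive means Lipschitz with constant $1$.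
   Formalization: The resolvent value and a fixed point of Q need not exist (C=0, M the normal cone of {1}), nor is the fixed point unique; so proved: each fixed point u gives the unique value y−λμCᵀu, and any resolvent value arises from some fixed point. For C=0, 2/‖C‖² is read as +∞. *)

theory Defs
  imports "HOL-Analysis.Analysis"
begin

text \<open>Set-valued operators on a real Hilbert space are functions into sets. Their graph need not
  be nonempty, and the value at a point may be empty.\<close>

definition monotone_operator :: "('a::real_inner \<Rightarrow> 'a set) \<Rightarrow> bool" where
  "monotone_operator A \<longleftrightarrow>
     (\<forall>x y. \<forall>u\<in>A x. \<forall>v\<in>A y. 0 \<le> (x - y) \<bullet> (u - v))"

definition maximal_monotone :: "('a::real_inner \<Rightarrow> 'a set) \<Rightarrow> bool" where
  "maximal_monotone A \<longleftrightarrow> monotone_operator A \<and>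
     (\<forall>B. monotone_operator B \<and> (\<forall>x. A x \<subseteq> B x) \<longrightarrow> B = A)"

definition scale_operator :: "real \<Rightarrow> ('a::real_inner \<Rightarrow> 'a set) \<Rightarrow> 'a \<Rightarrow> 'a set" where
  "scale_operator c A x = (\<lambda>u. c *\<^sub>R u) ` A x"

definition composite :: "('a::real_inner \<Rightarrow> 'b::real_inner) \<Rightarrow> ('b \<Rightarrow> 'b set) \<Rightarrow> 'a \<Rightarrow> 'a set" where
  "composite C M x = {adjoint C u |u. u \<in> M (C x)}"

definition resolvent :: "('a::real_inner \<Rightarrow> 'a set) \<Rightarrow> 'a \<Rightarrow> 'a set" where
  "resolvent A y = {x. y \<in> (\<lambda>u. x + u) ` A x}"

text \<open>The resolvent as a point-valued map; the value is meaningful only at points where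
  \<^const>\<open>resolvent\<close> is a singleton.\<close>

definition resolvent_map :: "('a::real_inner \<Rightarrow> 'a set) \<Rightarrow> 'a \<Rightarrow> 'a" where
  "resolvent_map A y = the_elem (resolvent A y)"

definition fixpoint_operator ::
  "('a::real_inner \<Rightarrow> 'b::real_inner) \<Rightarrow> ('b \<Rightarrow> 'b set) \<Rightarrow> real \<Rightarrow> real \<Rightarrow> 'a \<Rightarrow> 'b \<Rightarrow> 'b" where
  "fixpoint_operator C M l m y u =
     (let z = C y + (u - (l * m) *\<^sub>R C (adjoint C u))
      in z - resolvent_map (scale_operator (1 / m) M) z)"

end

theory Submission
  imports Defs
begin

text \<open>
  Everything rests on one existence result: a quadratic-plus-linear functional
  \<open>t + \<bar>w\<bar>\<^sup>2 / 2\<close> that is bounded below on a nonempty closed convex subset of \<open>H \<times> \<real>\<close>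
  has a minimiser there, because the parallelogram law makes minimising sequences Cauchy
  (\<open>convex_proximal_point\<close>). Applied to the graph of \<open>- f\<close>, with \<open>f\<close> a bounded linear
  functional, it gives the Riesz representation theorem, hence adjoints exist. Applied to the
  epigraph of the Fitzpatrick function
  \<open>F (x, u) = sup {x \<bullet> b + a \<bullet> u - a \<bullet> b | (a, b) \<in> G}\<close> of a maximal monotone graph \<open>G\<close>
  it yields Minty's theorem (\<open>minty\<close>): the vector part of the minimiser is forced to lie in \<open>G\<close>
  and on the antidiagonal. Consequently every resolvent of \<open>M\<close> is single-valued and everywhere
  defined.

  Given this, the fixed-point characterisation is a change of variables. With
  \<open>x = y - l m C\<^sup>T u\<close> one has \<open>C y + (I - l m C C\<^sup>T) u = C x + u\<close>, so
  \<open>u = Q u\<close> says \<open>J (C x + u) = C x\<close>, that is \<open>m u \<in> M (C x)\<close>, which in turn says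
  \<open>y \<in> x + l C\<^sup>T M (C x)\<close>; the solution \<open>x\<close> is unique because \<open>C\<^sup>T M C\<close> is monotone.
  Finally, \<open>Q\<close> is \<open>I - J\<close>, which is nonexpansive by monotonicity, after an affine map with linear
  part \<open>I - l m C C\<^sup>T\<close>, and the norm of the latter is estimated by expanding the square.
\<close>

section \<open>Minimising a quadratic over a closed convex set\<close>

text \<open>The minimiser \<open>(w, t)\<close> of \<open>t + \<bar>w\<bar>\<^sup>2 / 2\<close> over \<open>S\<close>, described by its first-order optimality
  condition. When \<open>S\<close> is the epigraph of a convex function \<open>f\<close>, the conclusion says that
  \<open>- w\<close> is a subgradient of \<open>f\<close> at \<open>w\<close>, i.e. that \<open>w\<close> is the proximal point of the origin.\<close>

lemma convex_proximal_point:
  fixes S :: "('a::{real_inner, complete_space} \<times> real) set"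
  assumes "closed S" "convex S" "S \<noteq> {}"
    and bound: "\<And>w t. (w, t) \<in> S \<Longrightarrow> B \<le> t + (norm w)\<^sup>2 / 2"
  obtains w t where "(w, t) \<in> S" "\<And>w' t'. (w', t') \<in> S \<Longrightarrow> t + w \<bullet> w \<le> t' + w \<bullet> w'"
proof -
  define h where "h s = snd s + (norm (fst s))\<^sup>2 / 2" for s :: "'a \<times> real"
  define I where "I = Inf (h ` S)"
  have bdd: "bdd_below (h ` S)"
    using bound by (intro bdd_belowI[of _ B]) (auto simp: h_def)
  have I_le: "I \<le> h s" if "s \<in> S" for s
    unfolding I_def using bdd that by (rule cINF_lower)
  have "\<exists>s\<in>S. h s < I + 1 / Suc n" for n
    using cInf_lessD[of "h ` S" "I + 1 / Suc n"] \<open>S \<noteq> {}\<close> by (auto simp: I_def)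
  then obtain s where s: "\<And>n. s n \<in> S" "\<And>n. h (s n) < I + 1 / Suc n"
    by metis
  have gap: "(norm (fst p - fst q))\<^sup>2 \<le> 4 * (h p + h q - 2 * I)" if "p \<in> S" "q \<in> S" for p q
  proof -
    have "(1/2) *\<^sub>R p + (1/2) *\<^sub>R q \<in> S"
      using \<open>convex S\<close> that by (intro convexD) auto
    from I_le[OF this] show ?thesis
      unfolding h_def power2_norm_eq_inner
      by (simp add: inner_simps inner_commute[of "fst q" "fst p"] field_simps)
  qed
  have "Cauchy (\<lambda>n. fst (s n))"
  proof (rule metric_CauchyI)
    fix e :: real assume "e > 0"
    then obtain N where N: "1 / Suc N < e\<^sup>2 / 8"
      using nat_approx_posE[of "e\<^sup>2 / 8"] by (metis divide_pos_pos zero_less_numeral zero_less_power)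
    have small: "h (s n) < I + e\<^sup>2 / 8" if "n \<ge> N" for n
    proof -
      have "1 / real (Suc n) \<le> 1 / Suc N"
        using that by (intro divide_left_mono) auto
      then show ?thesis using s(2)[of n] N by linarith
    qed
    have "dist (fst (s i)) (fst (s j)) < e" if "i \<ge> N" "j \<ge> N" for i j
    proof -
      have "h (s i) + h (s j) - 2 * I < e\<^sup>2 / 4"
        using small[OF that(1)] small[OF that(2)] by simp
      then have "4 * (h (s i) + h (s j) - 2 * I) < e\<^sup>2" by simp
      with gap[OF s(1)[of i] s(1)[of j]] have "(norm (fst (s i) - fst (s j)))\<^sup>2 < e\<^sup>2"
        by (rule order_le_less_trans)
      then show ?thesis
        using \<open>e > 0\<close> by (simp add: dist_norm power_less_imp_less_base)
    qed
    then show "\<exists>M. \<forall>m\<ge>M. \<forall>n\<ge>M. dist (fst (s m)) (fst (s n)) < e" by blast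
  qed
  then obtain w where w: "(\<lambda>n. fst (s n)) \<longlonglongrightarrow> w"
    using Cauchy_convergent convergent_def by blast
  have hI: "(\<lambda>n. h (s n)) \<longlonglongrightarrow> I"
  proof (rule tendsto_sandwich[where f = "\<lambda>_. I" and h = "\<lambda>n. I + 1 / Suc n"])
    show "(\<lambda>n. I + 1 / Suc n) \<longlonglongrightarrow> I"
      using tendsto_add[OF tendsto_const LIMSEQ_inverse_real_of_nat, of I]
      by (simp add: inverse_eq_divide)
  qed (use I_le s in \<open>auto intro!: always_eventually less_imp_le\<close>)
  \<comment> \<open>The scalar components converge as well, since the functional values and the vectors do.\<close>
  define t where "t = I - (norm w)\<^sup>2 / 2"
  have "(\<lambda>n. h (s n) - (norm (fst (s n)))\<^sup>2 / 2) \<longlonglongrightarrow> t"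
    unfolding t_def by (intro tendsto_intros hI w) auto
  then have "(\<lambda>n. snd (s n)) \<longlonglongrightarrow> t" by (simp add: h_def)
  then have "s \<longlonglongrightarrow> (w, t)"
    using tendsto_Pair[OF w] by fastforce
  then have wt: "(w, t) \<in> S"
    using \<open>closed S\<close> s(1) closed_sequentially by blast
  have h_wt: "h (w, t) = I" by (simp add: h_def t_def)
  have "t + w \<bullet> w \<le> t' + w \<bullet> w'" if S': "(w', t') \<in> S" for w' t'
  proof -
    define d where "d = t' - t + w \<bullet> (w' - w)"
    define k where "k = (norm (w' - w))\<^sup>2 / 2"
    \<comment> \<open>Comparing the minimiser with nearby points of the segment towards \<open>(w', t')\<close>.\<close>
    have step: "0 \<le> d + e * k" if e: "0 < e" "e \<le> 1" for e
    proof -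
      have "(1 - e) *\<^sub>R (w, t) + e *\<^sub>R (w', t') \<in> S"
        using \<open>convex S\<close> wt S' e by (intro convexD) auto
      from I_le[OF this] have "h (w, t) \<le> h ((1 - e) *\<^sub>R (w, t) + e *\<^sub>R (w', t'))"
        unfolding h_wt .
      also have "(1 - e) *\<^sub>R (w, t) + e *\<^sub>R (w', t') = (w + e *\<^sub>R (w' - w), t + e * (t' - t))"
        by (simp add: algebra_simps)
      also have "h \<dots> = h (w, t) + e * (d + e * k)"
        unfolding h_def fst_conv snd_conv power2_norm_eq_inner d_def k_def
        by (simp add: inner_simps inner_commute[of w' w] field_simps)
      finally show ?thesis using e by (simp add: zero_le_mult_iff)
    qed
    have "((\<lambda>e. d + e * k) \<longlongrightarrow> d + 0 * k) (at_right 0)"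
      by (intro tendsto_intros)
    moreover have "\<forall>\<^sub>F e in at_right 0. 0 \<le> d + e * k"
      using eventually_at_right_real[OF zero_less_one] by eventually_elim (auto intro: step)
    ultimately have "0 \<le> d + 0 * k"
      by (rule tendsto_lowerbound) simp
    then show ?thesis by (simp add: d_def inner_simps)
  qed
  with wt that show thesis by blast
qed

section \<open>Adjoints of bounded operators\<close>

text \<open>The representing vector minimises \<open>\<bar>x\<bar>\<^sup>2 / 2 - f x\<close>.\<close>

lemma riesz_representation:
  fixes f :: "'a::{real_inner, complete_space} \<Rightarrow> real"
  assumes "bounded_linear f"
  obtains r where "\<And>x. f x = x \<bullet> r"
proof -
  interpret f: bounded_linear f by fact
  define S where "S = {(x, t). t = - f x}"
  have "closed S"
  proof -
    have "S = {p. snd p = - f (fst p)}" by (auto simp: S_def)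
    moreover have "closed {p. snd p = - f (fst p)}"
      by (intro closed_Collect_eq continuous_intros f.continuous_on)
    ultimately show ?thesis by simp
  qed
  moreover have "convex S"
    by (auto simp: S_def convex_def f.add f.scaleR)
  moreover have "S \<noteq> {}" by (auto simp: S_def)
  moreover obtain K where K: "\<And>x. norm (f x) \<le> norm x * K"
    using f.bounded by blast
  \<comment> \<open>Completing the square gives the lower bound.\<close>
  have "- K\<^sup>2 / 2 \<le> t + (norm w)\<^sup>2 / 2" if "(w, t) \<in> S" for w t
  proof -
    have "f w \<le> norm w * K" using K[of w] by simp
    moreover have "0 \<le> (norm w - K)\<^sup>2" by simp
    ultimately show ?thesis
      using that by (simp add: S_def power2_eq_square algebra_simps)
  qed
  ultimately obtain r t where r: "(r, t) \<in> S"
    "\<And>w' t'. (w', t') \<in> S \<Longrightarrow> t + r \<bullet> r \<le> t' + r \<bullet> w'"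
    using convex_proximal_point[of S "- K\<^sup>2 / 2"] by blast
  have le: "f x \<le> r \<bullet> x" for x
    using r(1) r(2)[of "r + x" "- f (r + x)"] by (simp add: S_def f.add inner_simps)
  have "f x = x \<bullet> r" for x
    using le[of x] le[of "- x"] by (simp add: f.neg inner_commute)
  then show thesis by (rule that)
qed

lemma adjoint_bounded_linear:
  fixes C :: "'a::{real_inner, complete_space} \<Rightarrow> 'b::real_inner"
  assumes "bounded_linear C"
  shows "x \<bullet> adjoint C y = C x \<bullet> y"
proof -
  have "\<exists>r. \<forall>x. C x \<bullet> y = x \<bullet> r" for y
    using riesz_representation[OF bounded_linear_compose[OF bounded_linear_inner_left assms]]
    by metis
  then have "\<exists>f'. \<forall>x y. C x \<bullet> y = x \<bullet> f' y" by metis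
  then have "\<forall>x y. C x \<bullet> y = x \<bullet> adjoint C y"
    unfolding adjoint_def by (rule someI_ex)
  then show ?thesis by simp
qed

lemma linear_adjoint:
  fixes C :: "'a::{real_inner, complete_space} \<Rightarrow> 'b::real_inner"
  assumes "bounded_linear C"
  shows "linear (adjoint C)"
  by (rule linearI; subst vector_eq_rdot[symmetric])
    (simp_all add: inner_simps inner_commute[of "adjoint C _"] adjoint_bounded_linear[OF assms])

section \<open>Minty's theorem\<close>

text \<open>Let \<open>F\<close> be the Fitzpatrick function of \<open>G\<close>. Maximality gives
  \<open>x \<bullet> u \<le> F (x, u)\<close>, with equality only on \<open>G\<close>. At the proximal point \<open>(x, u)\<close> of
  the origin, the optimality condition tested on \<open>G\<close> reads
  \<open>F (x, u) + F (- u, - x) \<le> - \<bar>x\<bar>\<^sup>2 - \<bar>u\<bar>\<^sup>2\<close>, whereas the left-hand side is at least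
  \<open>2 (x \<bullet> u)\<close>. So \<open>\<bar>x + u\<bar>\<^sup>2 \<le> 0\<close> and equality holds throughout.\<close>

lemma minty:
  fixes G :: "('a::{real_inner, complete_space} \<times> 'a) set"
  assumes mono: "\<And>a b a' b'. (a, b) \<in> G \<Longrightarrow> (a', b') \<in> G \<Longrightarrow> 0 \<le> (a - a') \<bullet> (b - b')"
    and max: "\<And>x u. (\<And>a b. (a, b) \<in> G \<Longrightarrow> 0 \<le> (x - a) \<bullet> (u - b)) \<Longrightarrow> (x, u) \<in> G"
  obtains x where "(x, - x) \<in> G"
proof -
  have F_ge: "x \<bullet> u \<le> t" if F: "\<And>a b. (a, b) \<in> G \<Longrightarrow> x \<bullet> b + a \<bullet> u - a \<bullet> b \<le> t" for x u t
  proof (rule ccontr)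
    assume "\<not> x \<bullet> u \<le> t"
    moreover from this have "(x, u) \<in> G"
      by (intro max) (use F in \<open>force simp: inner_simps\<close>)
    ultimately show False using F[of x u] by simp
  qed
  \<comment> \<open>The epigraph of \<open>F\<close>.\<close>
  define E where "E = (\<Inter>(a, b)\<in>G. {((x, u), t). x \<bullet> b + a \<bullet> u - a \<bullet> b \<le> t})"
  have E_iff: "((x, u), t) \<in> E \<longleftrightarrow> (\<forall>(a, b)\<in>G. x \<bullet> b + a \<bullet> u - a \<bullet> b \<le> t)" for x u t
    by (auto simp: E_def)
  have "closed E"
  proof -
    have "closed {((x::'a, u), t). x \<bullet> b + a \<bullet> u - a \<bullet> b \<le> t}" for a b
      unfolding case_prod_beta
      by (intro closed_Collect_le continuous_intros)
    then show ?thesis unfolding E_def by (intro closed_INT) auto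
  qed
  moreover have "convex E"
  proof -
    have "convex {((x::'a, u), t). x \<bullet> b + a \<bullet> u - a \<bullet> b \<le> t}" for a b
    proof (rule convexI, clarsimp)
      fix x u x' u' :: 'a and t t' p q :: real
      assume 1: "x \<bullet> b + a \<bullet> u - a \<bullet> b \<le> t" and 2: "x' \<bullet> b + a \<bullet> u' - a \<bullet> b \<le> t'"
        and pq: "0 \<le> p" "0 \<le> q" "p + q = 1"
      have "p * (x \<bullet> b + a \<bullet> u - a \<bullet> b) + q * (x' \<bullet> b + a \<bullet> u' - a \<bullet> b) \<le> p * t + q * t'"
        using 1 2 pq by (intro add_mono mult_left_mono)
      moreover have "a \<bullet> b = p * (a \<bullet> b) + q * (a \<bullet> b)"
        using pq by (metis distrib_right mult_1)
      ultimately
      show "(p *\<^sub>R x + q *\<^sub>R x') \<bullet> b + a \<bullet> (p *\<^sub>R u + q *\<^sub>R u') - a \<bullet> b \<le> p * t + q * t'"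
        by (simp add: inner_simps algebra_simps)
    qed
    then show ?thesis unfolding E_def by (intro convex_INT) auto
  qed
  moreover have G_E: "((a, b), a \<bullet> b) \<in> E" if "(a, b) \<in> G" for a b
    using mono[OF that] by (fastforce simp: E_iff inner_simps)
  \<comment> \<open>If \<open>G\<close> were empty, the origin would vacuously satisfy the maximality condition.\<close>
  moreover have "E \<noteq> {}"
    using max[of 0 0] G_E by blast
  moreover have "0 \<le> t + (norm w)\<^sup>2 / 2" if "(w, t) \<in> E" for w t
  proof (cases w)
    case (Pair x u)
    have "x \<bullet> u \<le> t"
      using that Pair by (intro F_ge) (auto simp: E_iff)
    moreover have "0 \<le> (x + u) \<bullet> (x + u)" by simp
    ultimately show ?thesis
      unfolding power2_norm_eq_inner Pair
      by (simp add: inner_simps inner_commute[of u x] field_simps)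
  qed
  ultimately obtain w t where wt: "(w, t) \<in> E"
    "\<And>w' t'. (w', t') \<in> E \<Longrightarrow> t + w \<bullet> w \<le> t' + w \<bullet> w'"
    using convex_proximal_point[of E 0] by blast
  obtain x u where w: "w = (x, u)" by force
  have F: "x \<bullet> b + a \<bullet> u - a \<bullet> b \<le> t" if "(a, b) \<in> G" for a b
    using wt(1) that by (auto simp: w E_iff)
  have "(- u) \<bullet> (- x) \<le> - t - x \<bullet> x - u \<bullet> u"
    by (rule F_ge) (use wt(2)[OF G_E] in \<open>force simp: w inner_simps inner_commute\<close>)
  moreover have "x \<bullet> u \<le> t" by (intro F_ge F)
  moreover have "0 \<le> (x + u) \<bullet> (x + u)" by simp
  ultimately have "(x + u) \<bullet> (x + u) = 0" and t: "t = x \<bullet> u"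
    by (simp_all add: inner_simps inner_commute)
  then have "u = - x"
    by (metis inner_eq_zero_iff add.commute eq_neg_iff_add_eq_0)
  moreover have "(x, u) \<in> G"
    by (intro max) (use F t in \<open>force simp: inner_simps inner_commute\<close>)
  ultimately show thesis using that by blast
qed

section \<open>Resolvents of monotone operators\<close>

lemma maximal_monotone_memI:
  assumes "maximal_monotone A" and rel: "\<And>a b. b \<in> A a \<Longrightarrow> 0 \<le> (x - a) \<bullet> (u - b)"
  shows "u \<in> A x"
proof -
  let ?B = "A(x := insert u (A x))"
  have mono: "monotone_operator A"
    and max: "\<And>B. monotone_operator B \<Longrightarrow> (\<And>x. A x \<subseteq> B x) \<Longrightarrow> B = A"
    using assms(1) by (auto simp: maximal_monotone_def)
  have rel': "0 \<le> (a - x) \<bullet> (b - u)" if "b \<in> A a" for a b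
    using rel[OF that] by (simp add: inner_simps)
  have "monotone_operator ?B"
    using mono rel rel' by (auto simp: monotone_operator_def)
  then have "?B = A" by (intro max) auto
  then show ?thesis by (metis fun_upd_same insertI1)
qed

lemma mem_resolvent_iff:
  "x \<in> resolvent (scale_operator c A) y \<longleftrightarrow> (\<exists>v\<in>A x. y = x + c *\<^sub>R v)"
  by (auto simp: resolvent_def scale_operator_def)

text \<open>Both single-valuedness of the resolvent and nonexpansiveness of \<open>I - J\<close> come from this
  estimate, a consequence of
  \<open>0 \<le> (p - p') \<bullet> ((z - p) - (z' - p'))\<close>.\<close>

lemma resolvent_firmly_nonexpansive:
  assumes "monotone_operator A" "c > 0"
    and "p \<in> resolvent (scale_operator c A) z" "p' \<in> resolvent (scale_operator c A) z'"
  shows "(norm (p - p'))\<^sup>2 + (norm ((z - p) - (z' - p')))\<^sup>2 \<le> (norm (z - z'))\<^sup>2"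
proof -
  obtain v v' where v: "v \<in> A p" "z = p + c *\<^sub>R v" and v': "v' \<in> A p'" "z' = p' + c *\<^sub>R v'"
    using assms(3,4) by (auto simp: mem_resolvent_iff)
  have "0 \<le> (p - p') \<bullet> (v - v')"
    using assms(1) v(1) v'(1) by (auto simp: monotone_operator_def)
  then have "0 \<le> (p - p') \<bullet> (c *\<^sub>R (v - v'))"
    using \<open>c > 0\<close> by simp
  moreover have "z - z' = (p - p') + c *\<^sub>R (v - v')" "(z - p) - (z' - p') = c *\<^sub>R (v - v')"
    by (simp_all add: v v' algebra_simps)
  ultimately show ?thesis
    unfolding power2_norm_eq_inner
    by (simp only: inner_add_left inner_add_right inner_commute[of "c *\<^sub>R (v - v')" "p - p'"])
qed

lemma resolvent_unique:
  assumes "monotone_operator A" "c > 0"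
    and "p \<in> resolvent (scale_operator c A) z" "p' \<in> resolvent (scale_operator c A) z"
  shows "p' = p"
proof -
  have "(norm (p - p'))\<^sup>2 + (norm ((z - p) - (z - p')))\<^sup>2 \<le> 0"
    using resolvent_firmly_nonexpansive[OF assms] by simp
  then have "(norm (p - p'))\<^sup>2 \<le> 0"
    using zero_le_power2[of "norm ((z - p) - (z - p'))"] by linarith
  then show ?thesis by simp
qed

lemma maximal_monotone_resolvent_singleton:
  fixes A :: "'a::{real_inner, complete_space} \<Rightarrow> 'a set"
  assumes "maximal_monotone A" "c > 0"
  shows "\<exists>p. resolvent (scale_operator c A) z = {p}"
proof -
  have mono: "monotone_operator A" using assms by (simp add: maximal_monotone_def)
  \<comment> \<open>The graph of \<open>c A - z\<close>; its antidiagonal points \<open>(p, - p)\<close> are the solutions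
    of \<open>z \<in> p + c A p\<close>.\<close>
  define G where "G = {(x, c *\<^sub>R v - z) | x v. v \<in> A x}"
  obtain p where "(p, - p) \<in> G"
  proof (rule minty)
    fix a b a' b' assume "(a, b) \<in> G" "(a', b') \<in> G"
    then obtain v v' where v: "v \<in> A a" "v' \<in> A a'" "b = c *\<^sub>R v - z" "b' = c *\<^sub>R v' - z"
      by (auto simp: G_def)
    then have "0 \<le> (a - a') \<bullet> (v - v')"
      using mono by (auto simp: monotone_operator_def)
    moreover have "b - b' = c *\<^sub>R (v - v')" by (simp add: v algebra_simps)
    ultimately show "0 \<le> (a - a') \<bullet> (b - b')" using \<open>c > 0\<close> by simp
  next
    fix x u assume rel: "\<And>a b. (a, b) \<in> G \<Longrightarrow> 0 \<le> (x - a) \<bullet> (u - b)"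
    have "(1 / c) *\<^sub>R (u + z) \<in> A x"
    proof (rule maximal_monotone_memI[OF assms(1)])
      fix a b assume "b \<in> A a"
      then have "0 \<le> (x - a) \<bullet> (u - (c *\<^sub>R b - z))"
        by (intro rel) (auto simp: G_def)
      also have "u - (c *\<^sub>R b - z) = c *\<^sub>R ((1 / c) *\<^sub>R (u + z) - b)"
        using \<open>c > 0\<close> by (simp add: algebra_simps)
      finally show "0 \<le> (x - a) \<bullet> ((1 / c) *\<^sub>R (u + z) - b)"
        using \<open>c > 0\<close> by (simp add: zero_le_mult_iff)
    qed
    moreover have "u = c *\<^sub>R ((1 / c) *\<^sub>R (u + z)) - z" using \<open>c > 0\<close> by simp
    ultimately show "(x, u) \<in> G" unfolding G_def by blast
  qed
  then obtain v where "v \<in> A p" "- p = c *\<^sub>R v - z" by (auto simp: G_def)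
  moreover from this have "z = p + c *\<^sub>R v"
    by (metis add_minus_cancel diff_add_cancel minus_diff_eq uminus_add_conv_diff)
  ultimately have "p \<in> resolvent (scale_operator c A) z"
    by (auto simp: mem_resolvent_iff)
  then show ?thesis
    using resolvent_unique[OF mono \<open>c > 0\<close>] by blast
qed

lemma maximal_monotone_resolvent_map_eq_iff:
  fixes A :: "'a::{real_inner, complete_space} \<Rightarrow> 'a set"
  assumes "maximal_monotone A" "c > 0"
  shows "resolvent_map (scale_operator c A) z = p \<longleftrightarrow> p \<in> resolvent (scale_operator c A) z"
proof -
  obtain q where "resolvent (scale_operator c A) z = {q}"
    using maximal_monotone_resolvent_singleton[OF assms] by blast
  then show ?thesis by (auto simp: resolvent_map_def)
qed

lemma monotone_composite:
  fixes C :: "'a::{real_inner, complete_space} \<Rightarrow> 'b::real_inner"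
  assumes "bounded_linear C" "monotone_operator M"
  shows "monotone_operator (composite C M)"
proof -
  interpret C: bounded_linear C by fact
  interpret adj: linear "adjoint C" by (rule linear_adjoint) fact
  have "0 \<le> (x - x') \<bullet> (adjoint C v - adjoint C v')" if "v \<in> M (C x)" "v' \<in> M (C x')" for x x' v v'
  proof -
    have "0 \<le> C (x - x') \<bullet> (v - v')"
      using assms(2) that by (simp add: monotone_operator_def C.diff)
    then show ?thesis
      by (simp add: adj.diff[symmetric] adjoint_bounded_linear[OF assms(1)])
  qed
  then show ?thesis by (auto simp: monotone_operator_def composite_def)
qed

section \<open>The fixed-point operator\<close>

text \<open>In terms of the primal point \<open>x = y - l m C\<^sup>T u\<close> the argument of the resolvent is
  \<open>C x + u\<close>, so a fixed point is exactly a \<open>u\<close> with \<open>J (C x + u) = C x\<close>.\<close>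

lemma fixpoint_operator_fixed_iff:
  fixes C :: "'a::{real_inner, complete_space} \<Rightarrow> 'b::{real_inner, complete_space}"
  assumes "bounded_linear C" "maximal_monotone M" "m > 0"
  shows "fixpoint_operator C M l m y u = u \<longleftrightarrow>
    m *\<^sub>R u \<in> M (C (y - (l * m) *\<^sub>R adjoint C u))"
proof -
  interpret C: bounded_linear C by fact
  let ?p = "C (y - (l * m) *\<^sub>R adjoint C u)"
  let ?J = "resolvent_map (scale_operator (1 / m) M)"
  have z: "C y + (u - (l * m) *\<^sub>R C (adjoint C u)) = ?p + u"
    by (simp add: C.diff C.scaleR)
  have "fixpoint_operator C M l m y u = u \<longleftrightarrow> ?J (?p + u) = ?p"
    unfolding fixpoint_operator_def Let_def z by (auto simp: algebra_simps)
  also have "\<dots> \<longleftrightarrow> ?p \<in> resolvent (scale_operator (1 / m) M) (?p + u)"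
    using assms by (intro maximal_monotone_resolvent_map_eq_iff) auto
  also have "\<dots> \<longleftrightarrow> (\<exists>v\<in>M ?p. u = (1 / m) *\<^sub>R v)"
    by (simp add: mem_resolvent_iff)
  also have "\<dots> \<longleftrightarrow> m *\<^sub>R u \<in> M ?p"
    using \<open>m > 0\<close> by (force intro!: bexI[of _ "m *\<^sub>R u"])
  finally show ?thesis .
qed

text \<open>Expanding the square,
  \<open>\<bar>v - t C C\<^sup>T v\<bar>\<^sup>2 = \<bar>v\<bar>\<^sup>2 - 2 t \<bar>C\<^sup>T v\<bar>\<^sup>2 + t\<^sup>2 \<bar>C C\<^sup>T v\<bar>\<^sup>2\<close>, and the last term is at most
  \<open>t (t \<bar>C\<bar>\<^sup>2) \<bar>C\<^sup>T v\<bar>\<^sup>2\<close>.\<close>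

lemma norm_diff_scaled_self_adjoint_le:
  fixes C :: "'a::{real_inner, complete_space} \<Rightarrow> 'b::real_inner"
  assumes "bounded_linear C" "0 \<le> t" "t * (onorm C)\<^sup>2 \<le> 2"
  shows "norm (v - t *\<^sub>R C (adjoint C v)) \<le> norm v"
proof -
  let ?a = "adjoint C v"
  have inner: "v \<bullet> C ?a = (norm ?a)\<^sup>2"
    unfolding power2_norm_eq_inner
    by (simp add: inner_commute[of v] adjoint_bounded_linear[OF assms(1), symmetric])
  have "norm (C ?a) \<le> onorm C * norm ?a" using assms(1) by (rule onorm)
  then have "(norm (C ?a))\<^sup>2 \<le> (onorm C)\<^sup>2 * (norm ?a)\<^sup>2"
    by (metis norm_ge_zero power_mono power_mult_distrib)
  then have "t\<^sup>2 * (norm (C ?a))\<^sup>2 \<le> t\<^sup>2 * ((onorm C)\<^sup>2 * (norm ?a)\<^sup>2)"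
    by (intro mult_left_mono) auto
  also have "\<dots> = t * (norm ?a)\<^sup>2 * (t * (onorm C)\<^sup>2)"
    by (simp add: power2_eq_square)
  also have "\<dots> \<le> t * (norm ?a)\<^sup>2 * 2"
    using assms(2,3) by (intro mult_left_mono) auto
  finally have "t\<^sup>2 * (norm (C ?a))\<^sup>2 \<le> 2 * t * (norm ?a)\<^sup>2" by simp
  moreover have "(norm (v - t *\<^sub>R C ?a))\<^sup>2 =
      (norm v)\<^sup>2 - 2 * t * (norm ?a)\<^sup>2 + t\<^sup>2 * (norm (C ?a))\<^sup>2"
    using inner
    unfolding power2_norm_eq_inner
    by (simp add: inner_simps inner_commute[of "C ?a" v] power2_eq_square algebra_simps)
  ultimately have "(norm (v - t *\<^sub>R C ?a))\<^sup>2 \<le> (norm v)\<^sup>2" by linarith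
  then show ?thesis by (rule power2_le_imp_le) simp
qed

lemma fixpoint_operator_nonexpansive:
  fixes C :: "'a::{real_inner, complete_space} \<Rightarrow> 'b::{real_inner, complete_space}"
  assumes "bounded_linear C" "maximal_monotone M" "0 \<le> l" "0 < m" "l * m * (onorm C)\<^sup>2 \<le> 2"
  shows "1-lipschitz_on UNIV (fixpoint_operator C M l m y)"
proof (rule lipschitz_onI)
  interpret C: bounded_linear C by fact
  interpret adj: linear "adjoint C" by (rule linear_adjoint) fact
  fix u u' :: 'b
  let ?J = "resolvent_map (scale_operator (1 / m) M)"
  define z where "z u = C y + (u - (l * m) *\<^sub>R C (adjoint C u))" for u
  have Q: "fixpoint_operator C M l m y u = z u - ?J (z u)" for u
    by (simp add: fixpoint_operator_def z_def Let_def)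
  have J: "?J w \<in> resolvent (scale_operator (1 / m) M) w" for w
    using maximal_monotone_resolvent_map_eq_iff[OF assms(2), of "1 / m", THEN iffD1] \<open>0 < m\<close>
    by simp
  have "(norm (?J (z u) - ?J (z u')))\<^sup>2 + (norm ((z u - ?J (z u)) - (z u' - ?J (z u'))))\<^sup>2
      \<le> (norm (z u - z u'))\<^sup>2"
    using assms by (intro resolvent_firmly_nonexpansive[OF _ _ J J]) (auto simp: maximal_monotone_def)
  then have "(norm ((z u - ?J (z u)) - (z u' - ?J (z u'))))\<^sup>2 \<le> (norm (z u - z u'))\<^sup>2"
    using zero_le_power2[of "norm (?J (z u) - ?J (z u'))"] by linarith
  then have "norm ((z u - ?J (z u)) - (z u' - ?J (z u'))) \<le> norm (z u - z u')"
    by (rule power2_le_imp_le) simp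
  also have "z u - z u' = (u - u') - (l * m) *\<^sub>R C (adjoint C (u - u'))"
    by (simp add: z_def adj.diff C.diff algebra_simps)
  also have "norm \<dots> \<le> norm (u - u')"
    using assms by (intro norm_diff_scaled_self_adjoint_le) auto
  finally show "dist (fixpoint_operator C M l m y u) (fixpoint_operator C M l m y u') \<le> 1 * dist u u'"
    by (simp add: Q dist_norm)
qed simp

theorem corollary7:
  fixes C :: "'a::{real_inner, complete_space} \<Rightarrow> 'b::{real_inner, complete_space}"
    and M :: "'b \<Rightarrow> 'b set"
    and l m :: real
    and y :: 'a
  assumes "bounded_linear C"
    and "maximal_monotone M"
    and "l > 0"
    and "m > 0"
  defines "Q \<equiv> fixpoint_operator C M l m y"
  shows "(\<forall>z. \<exists>p. resolvent (scale_operator (1 / m) M) z = {p})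
    \<and> (\<forall>u. Q u = u \<longrightarrow>
          resolvent (scale_operator l (composite C M)) y = {y - (l * m) *\<^sub>R adjoint C u})
    \<and> (\<forall>x \<in> resolvent (scale_operator l (composite C M)) y.
          \<exists>u. Q u = u \<and> x = y - (l * m) *\<^sub>R adjoint C u)
    \<and> (onorm C = 0 \<or> l * m \<le> 2 / (onorm C)\<^sup>2 \<longrightarrow>
          onorm (\<lambda>v. v - (l * m) *\<^sub>R C (adjoint C v)) \<le> 1 \<and> 1-lipschitz_on UNIV Q)"
proof (intro conjI allI impI ballI)
  interpret adj: linear "adjoint C" by (rule linear_adjoint) fact
  let ?R = "resolvent (scale_operator l (composite C M)) y"
  have mono: "monotone_operator (composite C M)"
    using assms by (intro monotone_composite) (auto simp: maximal_monotone_def)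
  have Q_iff: "Q u = u \<longleftrightarrow> m *\<^sub>R u \<in> M (C (y - (l * m) *\<^sub>R adjoint C u))" for u
    unfolding Q_def using assms by (intro fixpoint_operator_fixed_iff)
  show "\<exists>p. resolvent (scale_operator (1 / m) M) z = {p}" for z
    using assms by (intro maximal_monotone_resolvent_singleton) auto
  show "?R = {y - (l * m) *\<^sub>R adjoint C u}" if "Q u = u" for u
  proof -
    let ?x = "y - (l * m) *\<^sub>R adjoint C u"
    have "adjoint C (m *\<^sub>R u) \<in> composite C M ?x"
      using that by (auto simp: Q_iff composite_def)
    then have "?x \<in> ?R"
      by (auto simp: mem_resolvent_iff adj.scale intro!: bexI[of _ "adjoint C (m *\<^sub>R u)"])
    then show ?thesis
      using resolvent_unique[OF mono \<open>l > 0\<close>] by blast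
  qed
  show "\<exists>u. Q u = u \<and> x = y - (l * m) *\<^sub>R adjoint C u" if "x \<in> ?R" for x
  proof -
    obtain v where v: "v \<in> M (C x)" "y = x + l *\<^sub>R adjoint C v"
      using \<open>x \<in> ?R\<close> by (auto simp: mem_resolvent_iff composite_def)
    have "x = y - (l * m) *\<^sub>R adjoint C ((1 / m) *\<^sub>R v)"
      using \<open>m > 0\<close> by (simp add: v(2) adj.scale)
    moreover from this have "Q ((1 / m) *\<^sub>R v) = (1 / m) *\<^sub>R v"
      using v(1) \<open>m > 0\<close> by (simp add: Q_iff)
    ultimately show ?thesis by blast
  qed
  assume small: "onorm C = 0 \<or> l * m \<le> 2 / (onorm C)\<^sup>2"
  have bound: "l * m * (onorm C)\<^sup>2 \<le> 2"
  proof (cases "onorm C = 0")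
    case False
    then have "0 < (onorm C)\<^sup>2" by simp
    then show ?thesis using small False by (simp add: pos_le_divide_eq)
  qed simp
  show "onorm (\<lambda>v. v - (l * m) *\<^sub>R C (adjoint C v)) \<le> 1"
    using norm_diff_scaled_self_adjoint_le[OF assms(1) _ bound] assms(3,4)
    by (intro onorm_bound) auto
  show "1-lipschitz_on UNIV Q"
    unfolding Q_def using assms bound by (intro fixpoint_operator_nonexpansive) auto
qed

end
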